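(* For every word $w$ over a finite alphabet, the algorithm $\mathrm{GetAnAttractor}$ applied to the suffix automaton (DAWG) $\mathcal{S}(w)$ of $w$ outputs a word attractor of $w$.
   Context: Let $w=w_1w_2\cdots w_n$ be a finite word over a finite alphabet, $n\ge 0$, $|w|=n$. Positions on $w$ are the elements of $\{1,\dots,n\}$. A factor of $w$ is a word $w_{[i,j]}=w_i\cdots w_j$ (the empty word if $j<i$). An occurrence of a non-empty factor $u$ in $w$ is a pair $(i,j)$, $1\le i\le j\le n$, with $u=w_{[i,j]}$; $j$ is its ending position. A set $P\subseteq\{1,\dots,n\}$ is a word attractor of $w$ if every non-empty factor $u$ of $w$ has an occurrence $(i,j)$ in $w$ with $i\le t\le j$ for some $t\in P$. Suffix automaton (DAWG): the states of $\mathcal{S}(w)$ are the equivalence classes of the factors of $w$ (including the empty word), where two factors are equivalent iff they have the same set of ending positions in $w$ (the empty word having ending positions $0,1,\dots,n$). $|\mathcal{S}(w)|$ is the number of states. The initial state $I$ is the class of the empty word. For a factor $u$, $\delta(I,u)$ is the class of $u$. For a state $q$, $\ell[q]$ is the minimum length of the factors in $q$ and $\mathrm{POS}[q]$ is the smallest ending position of any factor in $q$ (so $\mathrm{POS}[I]=0$). Suffix links: for a state $q\neq I$ and any factor $x\in q$, $F[q]$ is the class of the longest suffix of $x$ that does not belong to $q$ (independent of the choice of $x$). The table of prefix states is $T[j]=\delta(I,w_{[1,j]})$ for $1\le j\le n$. Algorithm $\mathrm{GetAnAttractor}(\mathcal{S}(w))$: Initialization: for all states $q$ set $d[q]\leftarrow+\infty$;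 set $P\leftarrow\emptyset$, $\mathit{checked}\leftarrow\{I\}$, $j\leftarrow|w|$. While $j>0$ do: (a) [stacking] set $i\leftarrow j$, $k\leftarrow 1$; while $k\le i$ do: set $q\leftarrow T[i]$; while $\mathrm{POS}[q]=i$ do { if $d[q]\ge\ell[q]$ then set $k\leftarrow\max\{k,\,i-\ell[q]+1\}$; set $q\leftarrow F[q]$ }; set $i\leftarrow i-1$. (b) [adding] set $P\leftarrow P\cup\{k\}$. (c) [updating] for $i=k,k+1,\dots,j$ in this order do: set $e\leftarrow i-k$, $q\leftarrow T[i]$; while $q\neq I$ and $e<d[q]$ do { set $d[q]\leftarrow e$; if $d[q]<\ell[q]$ then { set $\mathit{checked}\leftarrow\mathit{checked}\cup\{q\}$; if $|\mathit{checked}|=|\mathcal{S}(w)|$ then return $P$ and stop }; set $q\leftarrow F[q]$ }. (d) set $j\leftarrow k-1$. *)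

theory Defs
  imports "HOL-Library.Sublist" "HOL-Library.Extended_Nat" "HOL-Library.Monad_Syntax"
begin

text \<open>Positions are numbered from 1. For \<open>i \<ge> 1\<close> the result is empty if \<open>j < i\<close>.\<close>

definition factor :: "'a list \<Rightarrow> nat \<Rightarrow> nat \<Rightarrow> 'a list" where
  "factor w i j = drop (i - 1) (take j w)"

definition factors :: "'a list \<Rightarrow> 'a list set" where
  "factors w = {factor w i j | i j. 1 \<le> i \<and> j \<le> length w}"

lemma factors_eq_sublists: "factors w = {u. sublist u w}"
proof (intro set_eqI iffI)
  fix u assume "u \<in> factors w"
  then obtain i j where "u = drop (i - 1) (take j w)"
    by (auto simp: factors_def factor_def)
  then show "u \<in> {u. sublist u w}"
    using sublist_order.order_trans[OF sublist_drop sublist_take] by auto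
next
  fix u assume "u \<in> {u. sublist u w}"
  then obtain ps ss where w: "w = ps @ u @ ss" by (auto simp: sublist_def)
  have "u = factor w (length ps + 1) (length ps + length u)"
    by (simp add: factor_def w)
  moreover have "length ps + length u \<le> length w" by (simp add: w)
  ultimately show "u \<in> factors w" unfolding factors_def
    by (intro CollectI exI[of _ "length ps + 1"] exI[of _ "length ps + length u"]) simp
qed

definition occurrence :: "'a list \<Rightarrow> 'a list \<Rightarrow> nat \<Rightarrow> nat \<Rightarrow> bool" where
  "occurrence w u i j \<longleftrightarrow> 1 \<le> i \<and> i \<le> j \<and> j \<le> length w \<and> u = factor w i j"

definition word_attractor :: "'a list \<Rightarrow> nat set \<Rightarrow> bool" where
  "word_attractor w P \<longleftrightarrow> P \<subseteq> {1..length w} \<and>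
     (\<forall>u\<in>factors w. u \<noteq> [] \<longrightarrow>
        (\<exists>i j. occurrence w u i j \<and> (\<exists>t\<in>P. i \<le> t \<and> t \<le> j)))"


subsection \<open>Suffix automaton\<close>

definition endpos :: "'a list \<Rightarrow> 'a list \<Rightarrow> nat set" where
  "endpos w u = (if u = [] then {0..length w} else {j. \<exists>i. occurrence w u i j})"

definition endpos_rel :: "'a list \<Rightarrow> ('a list \<times> 'a list) set" where
  "endpos_rel w = {(u, v). u \<in> factors w \<and> v \<in> factors w \<and> endpos w u = endpos w v}"

lemma equiv_endpos_rel: "equiv (factors w) (endpos_rel w)"
  by (rule equivI) (auto simp: endpos_rel_def refl_on_def sym_def trans_def)

definition states :: "'a list \<Rightarrow> 'a list set set" where
  "states w = factors w // endpos_rel w"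

text \<open>The state reached from the initial state by reading the factor \<open>u\<close>.\<close>

definition delta_init :: "'a list \<Rightarrow> 'a list \<Rightarrow> 'a list set" where
  "delta_init w u = endpos_rel w `` {u}"

definition init :: "'a list \<Rightarrow> 'a list set" where
  "init w = delta_init w []"

definition minlen :: "'a list set \<Rightarrow> nat" where
  "minlen q = Min (length ` q)"

definition pos :: "'a list \<Rightarrow> 'a list set \<Rightarrow> nat" where
  "pos w q = Min (\<Union>u\<in>q. endpos w u)"

text \<open>Only meaningful for states \<open>q \<noteq> init w\<close>: then the empty suffix is not in \<open>q\<close>, and the
  resulting class does not depend on the chosen \<open>x\<close>.\<close>

definition suffix_link :: "'a list \<Rightarrow> 'a list set \<Rightarrow> 'a list set" where
  "suffix_link w q =
     (let x = (SOME x. x \<in> q)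
      in delta_init w (ARG_MAX length s. suffix s x \<and> s \<notin> q))"

definition prefix_state :: "'a list \<Rightarrow> nat \<Rightarrow> 'a list set" where
  "prefix_state w j = delta_init w (factor w 1 j)"


subsection \<open>The algorithm\<close>

text \<open>
  Each while loop is a tail-recursive partial function whose arguments are the variables it
  reads or modifies. The value \<open>None\<close> stands for divergence.
\<close>

type_synonym 'a dist = "'a list set \<Rightarrow> enat"

text \<open>
  In \<open>stack_links\<close> we write \<open>i + 1 - minlen q\<close> for \<open>i - minlen q + 1\<close>; no truncation occurs,
  since \<open>pos w q = i\<close> implies \<open>minlen q \<le> i\<close>.
\<close>

partial_function (option) stack_links ::
    "'a list \<Rightarrow> 'a dist \<Rightarrow> nat \<Rightarrow> nat \<Rightarrow> 'a list set \<Rightarrow> nat option" where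
  "stack_links w d i k q =
     (if pos w q = i
      then stack_links w d i
             (if d q \<ge> enat (minlen q) then max k (i + 1 - minlen q) else k)
             (suffix_link w q)
      else Some k)"

partial_function (option) stacking ::
    "'a list \<Rightarrow> 'a dist \<Rightarrow> nat \<Rightarrow> nat \<Rightarrow> nat option" where
  "stacking w d i k =
     (if k \<le> i
      then do {
        k' \<leftarrow> stack_links w d i k (prefix_state w i);
        stacking w d (i - 1) k'
      }
      else Some k)"

text \<open>
  The Boolean in the results of \<open>update_links\<close>, \<open>updating\<close> and \<open>main_loop\<close> tells whether the
  instruction \<open>return P\<close> was executed.
\<close>

partial_function (option) update_links ::
    "'a list \<Rightarrow> nat \<Rightarrow> 'a list set \<Rightarrow> 'a dist \<Rightarrow> 'a list set set
       \<Rightarrow> ('a dist \<times> 'a list set set \<times> bool) option" where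
  "update_links w e q d checked =
     (if q \<noteq> init w \<and> enat e < d q
      then (let d' = d(q := enat e) in
            if d' q < enat (minlen q)
            then (let checked' = insert q checked in
                  if card checked' = card (states w)
                  then Some (d', checked', True)
                  else update_links w e (suffix_link w q) d' checked')
            else update_links w e (suffix_link w q) d' checked)
      else Some (d, checked, False))"

partial_function (option) updating ::
    "'a list \<Rightarrow> nat \<Rightarrow> nat \<Rightarrow> nat \<Rightarrow> 'a dist \<Rightarrow> 'a list set set
       \<Rightarrow> ('a dist \<times> 'a list set set \<times> bool) option" where
  "updating w k j i d checked =
     (if i \<le> j
      then do {
        (d', checked', returned) \<leftarrow> update_links w (i - k) (prefix_state w i) d checked;
        if returned then Some (d', checked', True)
        else updating w k j (i + 1) d' checked'
      }
      else Some (d, checked, False))"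

partial_function (option) main_loop ::
    "'a list \<Rightarrow> nat \<Rightarrow> 'a dist \<Rightarrow> 'a list set set \<Rightarrow> nat set
       \<Rightarrow> (nat set \<times> bool) option" where
  "main_loop w j d checked P =
     (if j > 0
      then do {
        k \<leftarrow> stacking w d j 1;
        (d', checked', returned) \<leftarrow> updating w k j k d checked;
        if returned then Some (insert k P, True)
        else main_loop w (k - 1) d' checked' (insert k P)
      }
      else Some (P, False))"

text \<open>
  \<open>get_an_attractor w = Some P\<close> means that the algorithm terminates and outputs \<open>P\<close>. For the
  empty word the initial set \<open>checked\<close> already contains the only state, the main loop is never
  entered, and the output is the initial \<open>P = {}\<close>. For all other words, leaving the main loop
  without executing \<open>return P\<close> does not count as an output.
\<close>

definition get_an_attractor :: "'a list \<Rightarrow> nat set option" where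
  "get_an_attractor w =
     do {
       (P, returned) \<leftarrow> main_loop w (length w) (\<lambda>_. \<infinity>) {init w} {};
       if returned \<or> w = [] then Some P else None
     }"

end

theory Submission
  imports Defs
begin

text \<open>
  Order the states by inclusion of their sets of ending positions. The suffix links leaving a state
  run through exactly the states above it, and \<open>d\<close> is antitone for this order, so an interrupted
  walk of the updating phase has nothing left to improve. Since \<open>d[q]\<close> is always the distance from
  some ending position of \<open>q\<close> down to a chosen position, \<open>d[q] < \<ell>[q]\<close> makes every factor in \<open>q\<close>
  cross the attractor. Stacking picks \<open>k\<close> so large that each state whose first ending position
  lies in \<open>{k..j}\<close> satisfies this inequality after the updating phase. Hence all states are checked
  by the time \<open>j\<close> would reach 0.
\<close>

subsection \<open>Ending positions of states\<close>

text \<open>The convention for the empty word is exactly what \<open>suffix []\<close> yields, so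
  most later arguments can treat all factors uniformly, through suffixes of prefixes of
  \<open>w\<close>.\<close>

lemma endpos_eq: "endpos w u = {j. j \<le> length w \<and> suffix u (take j w)}"
proof (cases "u = []")
  case False
  have "j \<in> endpos w u \<longleftrightarrow> j \<le> length w \<and> suffix u (take j w)" for j
  proof
    assume "j \<in> endpos w u"
    then show "j \<le> length w \<and> suffix u (take j w)"
      using False by (auto simp: endpos_def occurrence_def factor_def suffix_drop)
  next
    assume *: "j \<le> length w \<and> suffix u (take j w)"
    then obtain ps where ps: "take j w = ps @ u" by (auto simp: suffix_def)
    have "length ps + length u = j" using arg_cong[OF ps, of length] * by simp
    moreover have "Suc 0 \<le> length u" using False by (cases u) auto
    ultimately have "occurrence w u (Suc (length ps)) j"
      using * ps unfolding occurrence_def factor_def by auto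
    then show "j \<in> endpos w u" using False by (auto simp: endpos_def)
  qed
  then show ?thesis by auto
qed (auto simp: endpos_def)

lemma endpos_suffix_mono: "suffix u v \<Longrightarrow> endpos w v \<subseteq> endpos w u"
  by (auto simp: endpos_eq intro: suffix_order.trans)

text \<open>Both words are suffixes of the same prefix \<open>take i w\<close>. This is why the
  states above a given state form a chain.\<close>

lemma endpos_suffix_linear:
  assumes "i \<in> endpos w u" "i \<in> endpos w v"
  shows "suffix u v \<or> suffix v u"
  using assms suffix_same_cases by (auto simp: endpos_eq)

lemma finite_factors: "finite (factors w)"
proof -
  have "factors w = set (sublists w)" by (simp add: factors_eq_sublists set_sublists_eq)
  then show ?thesis by simp
qed

lemma factors_suffix: "v \<in> factors w \<Longrightarrow> suffix u v \<Longrightarrow> u \<in> factors w"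
  by (auto simp: factors_eq_sublists intro: sublist_order.order_trans suffix_imp_sublist)

lemma endpos_nonempty: "u \<in> factors w \<Longrightarrow> endpos w u \<noteq> {}"
proof -
  assume "u \<in> factors w"
  then obtain ps ss where w: "w = ps @ u @ ss"
    by (auto simp: factors_eq_sublists sublist_def)
  then have "length ps + length u \<in> endpos w u" by (auto simp: endpos_eq suffix_def)
  then show ?thesis by blast
qed

text \<open>All members of a state have the same ending positions, so the union is that common set.
  Taking the union avoids choosing a representative and matches the body of
  \<open>pos\<close>.\<close>

definition state_endpos :: "'a list \<Rightarrow> 'a list set \<Rightarrow> nat set" where
  "state_endpos w q = (\<Union>u\<in>q. endpos w u)"

section \<open>States as classes determined by their ending positions\<close>

lemma delta_init_eq:
  "u \<in> factors w \<Longrightarrow> delta_init w u = {v \<in> factors w. endpos w v = endpos w u}"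
  by (auto simp: delta_init_def endpos_rel_def)

lemma delta_init_in_states: "u \<in> factors w \<Longrightarrow> delta_init w u \<in> states w"
  by (simp add: delta_init_def states_def quotientI)

lemma state_endpos_delta_init: "u \<in> factors w \<Longrightarrow> state_endpos w (delta_init w u) = endpos w u"
  by (auto simp: state_endpos_def delta_init_eq)

lemma statesE:
  assumes "q \<in> states w"
  obtains u where "u \<in> factors w" "q = delta_init w u"
  using assms by (auto simp: states_def delta_init_def elim: quotientE)

lemma finite_states: "finite (states w)"
  unfolding states_def
  by (rule finite_quotient) (auto simp: endpos_rel_def finite_factors)

lemma states_eq: "q \<in> states w \<Longrightarrow> q = {v \<in> factors w. endpos w v = state_endpos w q}"
  by (metis delta_init_eq state_endpos_delta_init statesE)

lemma states_memD:
  assumes "q \<in> states w" "u \<in> q"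
  shows "u \<in> factors w" "endpos w u = state_endpos w q" "q = delta_init w u"
proof -
  show *: "u \<in> factors w" "endpos w u = state_endpos w q"
    using assms states_eq by blast+
  show "q = delta_init w u"
    using delta_init_eq[OF *(1)] states_eq[OF assms(1)] *(2) by simp
qed

lemma states_eqI:
  "p \<in> states w \<Longrightarrow> q \<in> states w \<Longrightarrow> state_endpos w p = state_endpos w q \<Longrightarrow> p = q"
  using states_eq by metis

lemma states_nonempty: "q \<in> states w \<Longrightarrow> q \<noteq> {}"
  by (metis (mono_tags, lifting) delta_init_eq empty_iff mem_Collect_eq statesE)

lemma state_endpos_bounds: "q \<in> states w \<Longrightarrow> state_endpos w q \<subseteq> {0..length w}"
  by (auto simp: state_endpos_def endpos_eq)

lemma finite_state_endpos: "q \<in> states w \<Longrightarrow> finite (state_endpos w q)"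
  using state_endpos_bounds finite_subset by blast

lemma state_endpos_nonempty: "q \<in> states w \<Longrightarrow> state_endpos w q \<noteq> {}"
  by (metis endpos_nonempty state_endpos_delta_init statesE)

lemma Nil_in_factors: "[] \<in> factors w"
  by (simp add: factors_eq_sublists)

lemma init_in_states: "init w \<in> states w"
  by (simp add: init_def delta_init_in_states Nil_in_factors)

lemma state_endpos_init: "state_endpos w (init w) = {0..length w}"
  by (simp add: init_def state_endpos_delta_init Nil_in_factors endpos_def)

lemma Nil_in_state: "q \<in> states w \<Longrightarrow> [] \<in> q \<Longrightarrow> q = init w"
  by (simp add: states_memD(3) init_def)

text \<open>Only the empty word ends at position 0. Hence the initial state is the only one whose
  first ending position is 0.\<close>

lemma zero_in_state_endpos:
  assumes "q \<in> states w" "0 \<in> state_endpos w q"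
  shows "q = init w"
proof -
  obtain u where "u \<in> q" "0 \<in> endpos w u" using assms(2) by (auto simp: state_endpos_def)
  then have "[] \<in> q" by (simp add: endpos_eq)
  then show ?thesis using assms(1) Nil_in_state by blast
qed

lemma state_endpos_above_init:
  assumes "q \<in> states w" "state_endpos w (init w) \<subseteq> state_endpos w q"
  shows "q = init w"
  using assms zero_in_state_endpos by (force simp: state_endpos_init)

section \<open>First ending positions and minimal lengths\<close>

lemma pos_eq: "pos w q = Min (state_endpos w q)"
  by (simp add: pos_def state_endpos_def)

lemma pos_in_state_endpos: "q \<in> states w \<Longrightarrow> pos w q \<in> state_endpos w q"
  by (simp add: pos_eq finite_state_endpos state_endpos_nonempty)

lemma pos_le: "q \<in> states w \<Longrightarrow> i \<in> state_endpos w q \<Longrightarrow> pos w q \<le> i"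
  by (simp add: pos_eq finite_state_endpos)

lemma pos_le_length: "q \<in> states w \<Longrightarrow> pos w q \<le> length w"
  using pos_in_state_endpos state_endpos_bounds by fastforce

lemma pos_pos: "q \<in> states w \<Longrightarrow> q \<noteq> init w \<Longrightarrow> 0 < pos w q"
  using pos_in_state_endpos zero_in_state_endpos by (metis gr0I)

lemma pos_init: "pos w (init w) = 0"
  using pos_le[OF init_in_states, of 0 w] by (simp add: state_endpos_init)

lemma finite_state: "q \<in> states w \<Longrightarrow> finite q"
  using states_memD(1) finite_factors by (metis finite_subset subsetI)

lemma minlen_le: "q \<in> states w \<Longrightarrow> u \<in> q \<Longrightarrow> minlen q \<le> length u"
  by (simp add: minlen_def finite_state)

lemma minlen_pos:
  assumes "q \<in> states w" "q \<noteq> init w"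
  shows "0 < minlen q"
proof -
  have "minlen q \<in> length ` q"
    unfolding minlen_def using assms finite_state states_nonempty by (intro Min_in) auto
  then show ?thesis using assms(2) Nil_in_state[OF assms(1)] by (auto intro!: gr0I)
qed

subsection \<open>Suffix links\<close>

text \<open>The link leads to the immediate successor of \<open>q\<close> under inclusion: any word
  with strictly more ending positions than \<open>x\<close> is a suffix of \<open>x\<close> outside
  \<open>q\<close>, hence a suffix of the longest such suffix \<open>s\<close>.\<close>

lemma suffix_link:
  assumes "q \<in> states w" "q \<noteq> init w"
  shows suffix_link_in_states: "suffix_link w q \<in> states w"
    and suffix_link_less: "state_endpos w q \<subset> state_endpos w (suffix_link w q)"
    and suffix_link_least: "\<And>q'. q' \<in> states w \<Longrightarrow> state_endpos w q \<subset> state_endpos w q' \<Longrightarrow>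
      state_endpos w (suffix_link w q) \<subseteq> state_endpos w q'"
proof -
  define x where "x = (SOME x. x \<in> q)"
  define s where "s = (ARG_MAX length s. suffix s x \<and> s \<notin> q)"
  have link: "suffix_link w q = delta_init w s"
    by (simp add: suffix_link_def x_def s_def)
  have x: "x \<in> q" unfolding x_def using states_nonempty[OF assms(1)] by (simp add: some_in_eq)
  \<comment> \<open>The empty suffix is a candidate, and candidate lengths are bounded by that of
    \<open>x\<close>, so the \<open>ARG_MAX\<close> is attained.\<close>
  have "[] \<notin> q" using assms Nil_in_state by blast
  then have "suffix [] x \<and> [] \<notin> q" by simp
  moreover have "\<forall>y. suffix y x \<and> y \<notin> q \<longrightarrow> length y < Suc (length x)"
    by (simp add: suffix_length_le le_imp_less_Suc)
  ultimately have s: "suffix s x \<and> s \<notin> q"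
    and max: "\<forall>y. suffix y x \<and> y \<notin> q \<longrightarrow> length y \<le> length s"
    unfolding s_def using arg_max_nat_lemma[of "\<lambda>s. suffix s x \<and> s \<notin> q" "[]" length] by blast+
  have sf: "s \<in> factors w" using s factors_suffix states_memD(1)[OF assms(1) x] by blast
  show st: "suffix_link w q \<in> states w" by (simp add: link delta_init_in_states sf)
  have ep: "state_endpos w (suffix_link w q) = endpos w s"
    by (simp add: link state_endpos_delta_init sf)
  have "state_endpos w q \<subseteq> endpos w s"
    using endpos_suffix_mono s states_memD(2)[OF assms(1) x] by metis
  moreover have "state_endpos w q \<noteq> endpos w s" using states_eq[OF assms(1)] s sf by blast
  ultimately show "state_endpos w q \<subset> state_endpos w (suffix_link w q)" using ep by auto
  fix q' assume q': "q' \<in> states w" "state_endpos w q \<subset> state_endpos w q'"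
  obtain y where y: "y \<in> q'" using states_nonempty[OF q'(1)] by blast
  have epy: "endpos w y = state_endpos w q'" using states_memD(2)[OF q'(1) y] .
  have epx: "endpos w x = state_endpos w q" using states_memD(2)[OF assms(1) x] .
  obtain i where "i \<in> state_endpos w q" using state_endpos_nonempty[OF assms(1)] by blast
  then have "suffix y x \<or> suffix x y" using endpos_suffix_linear epx epy q'(2) by blast
  \<comment> \<open>If \<open>x\<close> were a suffix of \<open>y\<close>, the inclusion between the
    two states would be reversed, against its strictness.\<close>
  then have "suffix y x" using endpos_suffix_mono[of x y w] epx epy q'(2) by auto
  moreover have "y \<notin> q" using states_memD(2)[OF assms(1)] epy q'(2) by auto
  ultimately have "suffix y s" using max s suffix_length_suffix by blast
  then show "state_endpos w (suffix_link w q) \<subseteq> state_endpos w q'"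
    using endpos_suffix_mono ep epy by metis
qed

text \<open>Peels the lowest state off the chain above \<open>q\<close>, which is the form needed
  for induction along a link walk.\<close>

lemma above_suffix_link_iff:
  assumes "q \<in> states w" "q \<noteq> init w" "q' \<in> states w"
  shows "state_endpos w q \<subseteq> state_endpos w q' \<longleftrightarrow>
    q' = q \<or> state_endpos w (suffix_link w q) \<subseteq> state_endpos w q'"
  using suffix_link_less[OF assms(1,2)] suffix_link_least[OF assms(1,2,3)] states_eqI assms by blast

lemma not_above_suffix_link:
  assumes "q \<in> states w" "q \<noteq> init w"
  shows "\<not> state_endpos w (suffix_link w q) \<subseteq> state_endpos w q"
  using suffix_link_less[OF assms] by blast

lemma suffix_link_measure:
  assumes "q \<in> states w" "q \<noteq> init w"
  shows "Suc (length w) - card (state_endpos w (suffix_link w q)) <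
    Suc (length w) - card (state_endpos w q)"
proof -
  have "card (state_endpos w q) < card (state_endpos w (suffix_link w q))"
    by (intro psubset_card_mono finite_state_endpos suffix_link_in_states suffix_link_less assms)
  moreover have "card (state_endpos w (suffix_link w q)) \<le> card {0..length w}"
    by (intro card_mono state_endpos_bounds suffix_link_in_states assms) simp
  ultimately show ?thesis by simp
qed

text \<open>Each link strictly enlarges a subset of \<open>{0..length w}\<close>, so every walk
  reaches the initial state. There the induction offers no hypothesis, since the link of
  \<open>init w\<close> is meaningless.\<close>

lemma link_induct [consumes 1, case_names step]:
  assumes "q \<in> states w"
    and "\<And>q. q \<in> states w \<Longrightarrow> (q \<noteq> init w \<Longrightarrow> P (suffix_link w q)) \<Longrightarrow> P q"
  shows "P q"
  using assms(1)
proof (induction "Suc (length w) - card (state_endpos w q)" arbitrary: q rule: less_induct)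
  case less
  then show ?case using assms(2) suffix_link_in_states suffix_link_measure by metis
qed

text \<open>Every factor ending at \<open>i\<close> is a suffix of \<open>take i w\<close>. So the
  links from \<open>prefix_state w i\<close> run through exactly the states that have
  \<open>i\<close> as an ending position.\<close>

lemma prefix_state:
  assumes "i \<le> length w"
  shows prefix_state_in_states: "prefix_state w i \<in> states w"
    and state_endpos_prefix_state: "i \<in> state_endpos w (prefix_state w i)"
    and prefix_state_least: "\<And>q. q \<in> states w \<Longrightarrow>
      state_endpos w (prefix_state w i) \<subseteq> state_endpos w q \<longleftrightarrow> i \<in> state_endpos w q"
proof -
  have eq: "prefix_state w i = delta_init w (take i w)"
    by (simp add: prefix_state_def factor_def)
  have f: "take i w \<in> factors w" by (simp add: factors_eq_sublists)
  show "prefix_state w i \<in> states w" by (simp add: eq f delta_init_in_states)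
  have ep: "state_endpos w (prefix_state w i) = endpos w (take i w)"
    by (simp add: eq f state_endpos_delta_init)
  show i: "i \<in> state_endpos w (prefix_state w i)" using assms by (simp add: ep endpos_eq)
  fix q assume q: "q \<in> states w"
  obtain u where u: "u \<in> q" using states_nonempty[OF q] by blast
  have "i \<in> state_endpos w q \<Longrightarrow> suffix u (take i w)"
    using states_memD(2)[OF q u] by (auto simp: endpos_eq)
  then show "state_endpos w (prefix_state w i) \<subseteq> state_endpos w q \<longleftrightarrow> i \<in> state_endpos w q"
    using i ep endpos_suffix_mono states_memD(2)[OF q u] by blast
qed

subsection \<open>Stacking\<close>

text \<open>Stopping at the first state with \<open>pos\<close> different from \<open>i\<close>
  loses nothing, because \<open>pos\<close> can only decrease along the chain.\<close>

lemma stack_links_spec: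
  assumes "q \<in> states w" "i \<in> state_endpos w q" "0 < i"
  shows "\<exists>k'. stack_links w d i k q = Some k' \<and> k \<le> k' \<and> k' \<le> max k i \<and>
    (\<forall>q'\<in>states w. state_endpos w q \<subseteq> state_endpos w q' \<longrightarrow> pos w q' = i \<longrightarrow>
      enat (minlen q') \<le> d q' \<longrightarrow> i + 1 - minlen q' \<le> k')"
  using assms
proof (induction arbitrary: k rule: link_induct)
  case (step q)
  show ?case
  proof (cases "pos w q = i")
    case True
    then have ni: "q \<noteq> init w" using step.prems(2) True pos_init[of w] by auto
    define k1 where "k1 = (if d q \<ge> enat (minlen q) then max k (i + 1 - minlen q) else k)"
    \<comment> \<open>Positivity of \<open>minlen q\<close> keeps the candidate
      \<open>i + 1 - minlen q\<close> at most \<open>i\<close>.\<close>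
    have k1: "k \<le> k1" "k1 \<le> max k i" "enat (minlen q) \<le> d q \<Longrightarrow> i + 1 - minlen q \<le> k1"
      using minlen_pos[OF step.hyps(1) ni] by (auto simp: k1_def)
    have "i \<in> state_endpos w (suffix_link w q)"
      using step.prems suffix_link_less[OF step.hyps(1) ni] by blast
    from step.IH[OF ni this step.prems(2), of k1] obtain k' where
      k': "stack_links w d i k1 (suffix_link w q) = Some k'" "k1 \<le> k'" "k' \<le> max k1 i"
      "\<forall>q'\<in>states w. state_endpos w (suffix_link w q) \<subseteq> state_endpos w q' \<longrightarrow> pos w q' = i \<longrightarrow>
        enat (minlen q') \<le> d q' \<longrightarrow> i + 1 - minlen q' \<le> k'" by blast
    have "stack_links w d i k q = Some k'"
      using k'(1) True by (subst stack_links.simps) (simp add: k1_def)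
    moreover have "\<forall>q'\<in>states w. state_endpos w q \<subseteq> state_endpos w q' \<longrightarrow> pos w q' = i \<longrightarrow>
        enat (minlen q') \<le> d q' \<longrightarrow> i + 1 - minlen q' \<le> k'"
      using k'(4) k1(3) k'(2) above_suffix_link_iff[OF step.hyps(1) ni] le_trans by blast
    ultimately show ?thesis using k'(2,3) k1 by auto
  next
    case False
    then have lt: "pos w q < i" using pos_le[OF step.hyps(1) step.prems(1)] by simp
    have "pos w q' \<noteq> i" if "q' \<in> states w" "state_endpos w q \<subseteq> state_endpos w q'" for q'
      using pos_le[OF that(1)] that(2) pos_in_state_endpos[OF step.hyps(1)] lt by fastforce
    moreover have "stack_links w d i k q = Some k"
      using False by (subst stack_links.simps) simp
    ultimately show ?thesis by auto
  qed
qed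

text \<open>Since \<open>k\<close> only grows, every position from the final \<open>k'\<close> up to
  \<open>i\<close> is visited before the loop stops. States first ending below \<open>k'\<close> are
  left to later rounds.\<close>

lemma stacking_spec:
  assumes "0 < k" "i \<le> length w"
  shows "\<exists>k'. stacking w d i k = Some k' \<and> k \<le> k' \<and> k' \<le> max k i \<and>
    (\<forall>q\<in>states w. k' \<le> pos w q \<longrightarrow> pos w q \<le> i \<longrightarrow>
      enat (minlen q) \<le> d q \<longrightarrow> pos w q + 1 - minlen q \<le> k')"
  using assms
proof (induction i arbitrary: k)
  case 0
  then show ?case by (subst stacking.simps) auto
next
  case (Suc i)
  show ?case
  proof (cases "k \<le> Suc i")
    case True
    have T: "prefix_state w (Suc i) \<in> states w"
      "Suc i \<in> state_endpos w (prefix_state w (Suc i))"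
      using Suc.prems prefix_state_in_states state_endpos_prefix_state by blast+
    from stack_links_spec[OF T, of d k] obtain k1 where
      k1: "stack_links w d (Suc i) k (prefix_state w (Suc i)) = Some k1" "k \<le> k1" "k1 \<le> Suc i"
      and k1_ge: "\<And>q. q \<in> states w \<Longrightarrow> Suc i \<in> state_endpos w q \<Longrightarrow> pos w q = Suc i \<Longrightarrow>
        enat (minlen q) \<le> d q \<Longrightarrow> Suc i + 1 - minlen q \<le> k1"
      using True prefix_state_least[OF Suc.prems(2)] by (auto simp: max_def split: if_splits)
    from Suc.IH[of k1] k1 Suc.prems obtain k' where
      k': "stacking w d i k1 = Some k'" "k1 \<le> k'" "k' \<le> max k1 i"
      and k'_ge: "\<And>q. q \<in> states w \<Longrightarrow> k' \<le> pos w q \<Longrightarrow> pos w q \<le> i \<Longrightarrow>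
        enat (minlen q) \<le> d q \<Longrightarrow> pos w q + 1 - minlen q \<le> k'" by auto
    have "stacking w d (Suc i) k = Some k'"
      using True k1(1) k'(1) by (subst stacking.simps) simp
    moreover have "pos w q + 1 - minlen q \<le> k'"
      if q: "q \<in> states w" "k' \<le> pos w q" "pos w q \<le> Suc i" "enat (minlen q) \<le> d q" for q
    proof (cases "pos w q = Suc i")
      case True
      then show ?thesis using k1_ge[OF q(1)] pos_in_state_endpos[OF q(1)] q(4) k'(2) by force
    next
      case False
      then show ?thesis using k'_ge[OF q(1,2)] q by simp
    qed
    ultimately show ?thesis using k1 k' by auto
  next
    case False
    then show ?thesis by (subst stacking.simps) auto
  qed
qed

subsection \<open>Updating\<close>

text \<open>The condition says that the shortest factor of \<open>q\<close>, placed so as to end at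
  \<open>i\<close>, contains \<open>t\<close>; longer factors of \<open>q\<close> then contain it
  too. The initial state is added by hand: its minimal length is 0, so no distance is
  smaller.\<close>

definition covered :: "'a list \<Rightarrow> nat set \<Rightarrow> 'a list set set" where
  "covered w P = insert (init w)
     {q \<in> states w. \<exists>i\<in>state_endpos w q. \<exists>t\<in>P. t \<le> i \<and> i - t < minlen q}"

lemma covered_subset_states: "covered w P \<subseteq> states w"
  by (auto simp: covered_def init_in_states)

lemma covered_mono: "P \<subseteq> Q \<Longrightarrow> covered w P \<subseteq> covered w Q"
  by (auto simp: covered_def)

text \<open>
  In the middle of a walk \<open>d\<close> is antitone only from the current state \<open>q\<close> upwards.
\<close>

definition antitone_above :: "'a list \<Rightarrow> 'a dist \<Rightarrow> 'a list set \<Rightarrow> bool" where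
  "antitone_above w d q \<longleftrightarrow>
     (\<forall>p\<in>states w. \<forall>p'\<in>states w. state_endpos w q \<subseteq> state_endpos w p \<longrightarrow>
        state_endpos w p \<subseteq> state_endpos w p' \<longrightarrow> p' \<noteq> init w \<longrightarrow> d p' \<le> d p)"

text \<open>The second conjunct is soundness of \<open>checked\<close>, the last one its
  completeness relative to \<open>d\<close>. The third records that the algorithm has not yet
  returned.\<close>

definition checked_inv ::
    "'a list \<Rightarrow> nat set \<Rightarrow> 'a dist \<Rightarrow> 'a list set set \<Rightarrow> bool" where
  "checked_inv w P d checked \<longleftrightarrow>
     init w \<in> checked \<and> checked \<subseteq> covered w P \<and> checked \<noteq> states w \<and>
     (\<forall>q\<in>states w. q \<noteq> init w \<longrightarrow> d q < enat (minlen q) \<longrightarrow> q \<in> checked)"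

text \<open>Unless the algorithm returns, the interrupted walk has the effect of a complete one:
  once \<open>d q\<close> is at most the new distance, antitonicity gives the same for all
  non-initial states above.\<close>

lemma update_links_spec:
  assumes "q \<in> states w" "i \<in> state_endpos w q" "k \<in> P" "k \<le> i"
    "antitone_above w d q" "checked_inv w P d checked"
  shows "\<exists>d' checked' ret. update_links w (i - k) q d checked = Some (d', checked', ret) \<and>
    (if ret then states w \<subseteq> covered w P
     else checked_inv w P d' checked' \<and>
       d' = (\<lambda>p. if p \<in> states w \<and> p \<noteq> init w \<and> state_endpos w q \<subseteq> state_endpos w p
                 then min (d p) (enat (i - k)) else d p))"
  using assms
proof (induction arbitrary: d checked rule: link_induct)
  case (step q)
  note q = step.hyps(1)
  show ?case
  proof (cases "q \<noteq> init w \<and> enat (i - k) < d q")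
    case True
    then have ni: "q \<noteq> init w" and lt: "enat (i - k) < d q" by auto
    define d1 where "d1 = d(q := enat (i - k))"
    define c1 where "c1 = (if i - k < minlen q then insert q checked else checked)"
    have i: "i \<in> state_endpos w (suffix_link w q)"
      using step.prems(1) suffix_link_less[OF q ni] by blast
    \<comment> \<open>A newly inserted \<open>q\<close> is covered with witnesses \<open>i\<close>
      and \<open>k\<close>.\<close>
    have c1_cov: "c1 \<subseteq> covered w P"
      using step.prems q unfolding c1_def checked_inv_def covered_def by auto
    show ?thesis
    proof (cases "c1 = states w")
      case full: True
      \<comment> \<open>\<open>checked\<close> was not yet full, so \<open>q\<close> has just been
        inserted and the cardinality test is reached.\<close>
      then have "c1 \<noteq> checked" using step.prems(5) by (auto simp: checked_inv_def)
      then have "i - k < minlen q" by (auto simp: c1_def split: if_splits)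
      then have "update_links w (i - k) q d checked = Some (d1, c1, True)"
        using True full unfolding c1_def d1_def
        by (subst update_links.simps) (auto simp: Let_def)
      then show ?thesis using c1_cov full by auto
    next
      case False
      \<comment> \<open>For subsets of the finite set of states, comparing cardinalities amounts to
        testing equality.\<close>
      have card: "card c1 \<noteq> card (states w)"
        using False c1_cov covered_subset_states finite_states
        by (metis card_subset_eq subset_trans)
      have inv1: "checked_inv w P d1 c1"
        using step.prems(5) c1_cov False
        by (auto simp: checked_inv_def c1_def d1_def split: if_splits)
      \<comment> \<open>The overwritten state \<open>q\<close> does not lie above its own link, so
        the modified value is never consulted.\<close>
      have "antitone_above w d1 (suffix_link w q)"
        unfolding antitone_above_def
      proof (intro ballI impI)
        fix p p'
        assume p: "p \<in> states w" "p' \<in> states w"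
          "state_endpos w (suffix_link w q) \<subseteq> state_endpos w p"
          "state_endpos w p \<subseteq> state_endpos w p'" "p' \<noteq> init w"
        then have "p \<noteq> q" "p' \<noteq> q" using not_above_suffix_link[OF q ni] by auto
        moreover have "state_endpos w q \<subseteq> state_endpos w p"
          using p suffix_link_less[OF q ni] by blast
        ultimately show "d1 p' \<le> d1 p"
          using step.prems(4) p by (auto simp: d1_def antitone_above_def)
      qed
      from step.IH[OF ni i step.prems(2,3) this inv1] obtain d' c' ret where
        IH: "update_links w (i - k) (suffix_link w q) d1 c1 = Some (d', c', ret)"
        "if ret then states w \<subseteq> covered w P
         else checked_inv w P d' c' \<and>
           d' = (\<lambda>p. if p \<in> states w \<and> p \<noteq> init w \<and>
                       state_endpos w (suffix_link w q) \<subseteq> state_endpos w p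
                     then min (d1 p) (enat (i - k)) else d1 p)" by blast
      have "update_links w (i - k) q d checked = Some (d', c', ret)"
        using True card IH(1) unfolding c1_def d1_def
        by (subst update_links.simps) (auto simp: Let_def split: if_splits)
      \<comment> \<open>At \<open>p = q\<close> the minimum is the new distance by the loop
        condition; elsewhere \<open>q\<close> and its link have the same states above them.\<close>
      moreover have "(if p \<in> states w \<and> p \<noteq> init w \<and>
            state_endpos w (suffix_link w q) \<subseteq> state_endpos w p
          then min (d1 p) (enat (i - k)) else d1 p) =
          (if p \<in> states w \<and> p \<noteq> init w \<and> state_endpos w q \<subseteq> state_endpos w p
          then min (d p) (enat (i - k)) else d p)" for p
        using lt ni q above_suffix_link_iff[OF q ni, of p]
        by (cases "p = q") (auto simp: d1_def min_def)
      ultimately show ?thesis using IH(2) by auto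
    qed
  next
    case False
    have "d p = min (d p) (enat (i - k))"
      if "p \<in> states w" "p \<noteq> init w" "state_endpos w q \<subseteq> state_endpos w p" for p
    proof -
      \<comment> \<open>The initial state has only itself above it, so the walk must have stopped
        because \<open>d q\<close> was already small enough.\<close>
      have "q \<noteq> init w" using state_endpos_above_init that by blast
      then have "d q \<le> enat (i - k)" using False by auto
      moreover have "d p \<le> d q" using step.prems(4) that q by (auto simp: antitone_above_def)
      ultimately show ?thesis by (metis min.absorb1 order_trans)
    qed
    then have "d = (\<lambda>p. if p \<in> states w \<and> p \<noteq> init w \<and> state_endpos w q \<subseteq> state_endpos w p
        then min (d p) (enat (i - k)) else d p)" by auto
    moreover have "update_links w (i - k) q d checked = Some (d, checked, False)"
      using False by (subst update_links.simps) auto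
    ultimately show ?thesis using step.prems(5) by auto
  qed
qed

definition dist_antitone :: "'a list \<Rightarrow> 'a dist \<Rightarrow> bool" where
  "dist_antitone w d \<longleftrightarrow> (\<forall>q\<in>states w. antitone_above w d q)"

text \<open>The walk for \<open>i\<close> takes the minimum with \<open>i - k\<close> on all
  non-initial states ending at \<open>i\<close>. The conclusion \<open>d' \<le> d\<close> lets
  bounds obtained at earlier positions survive the later walks.\<close>

lemma updating_spec:
  assumes "k \<in> P" "k \<le> i" "j \<le> length w" "dist_antitone w d" "checked_inv w P d checked"
  shows "\<exists>d' checked' ret. updating w k j i d checked = Some (d', checked', ret) \<and>
    (if ret then states w \<subseteq> covered w P
     else checked_inv w P d' checked' \<and> dist_antitone w d' \<and> d' \<le> d \<and>
       (\<forall>q\<in>states w. q \<noteq> init w \<longrightarrow>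
          (\<forall>i'\<in>state_endpos w q. i \<le> i' \<longrightarrow> i' \<le> j \<longrightarrow> d' q \<le> enat (i' - k))))"
  using assms
proof (induction "Suc j - i" arbitrary: i d checked)
  case 0
  then show ?case by (subst updating.simps) auto
next
  case (Suc n)
  then have ij: "i \<le> j" and il: "i \<le> length w" by auto
  let ?q = "prefix_state w i"
  have "antitone_above w d ?q"
    using Suc.prems(4) prefix_state_in_states[OF il] by (auto simp: dist_antitone_def)
  from update_links_spec[OF prefix_state_in_states[OF il] state_endpos_prefix_state[OF il]
      Suc.prems(1,2) this Suc.prems(5)]
  obtain d1 c1 r1 where
    u: "update_links w (i - k) ?q d checked = Some (d1, c1, r1)"
    and r1: "if r1 then states w \<subseteq> covered w P
     else checked_inv w P d1 c1 \<and>
       d1 = (\<lambda>p. if p \<in> states w \<and> p \<noteq> init w \<and> state_endpos w ?q \<subseteq> state_endpos w p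
                 then min (d p) (enat (i - k)) else d p)" by blast
  show ?case
  proof (cases r1)
    case True
    then have "updating w k j i d checked = Some (d1, c1, True)"
      using u ij by (subst updating.simps) simp
    then show ?thesis using r1 True by auto
  next
    case False
    then have inv1: "checked_inv w P d1 c1"
      and d1: "d1 = (\<lambda>p. if p \<in> states w \<and> p \<noteq> init w \<and> i \<in> state_endpos w p
                 then min (d p) (enat (i - k)) else d p)"
      using r1 prefix_state_least[OF il] by (auto simp: fun_eq_iff)
    \<comment> \<open>The states ending at \<open>i\<close> are closed upwards: whenever
      \<open>p\<close> is lowered, so is \<open>p'\<close>.\<close>
    have "d1 p' \<le> d1 p" if "p \<in> states w" "p' \<in> states w" "p' \<noteq> init w"
      "state_endpos w p \<subseteq> state_endpos w p'" for p p'
    proof -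
      have "d p' \<le> d p"
        using Suc.prems(4) that by (auto simp: dist_antitone_def antitone_above_def)
      then show ?thesis using that by (auto simp: d1 min_def)
    qed
    then have anti: "dist_antitone w d1" by (auto simp: dist_antitone_def antitone_above_def)
    have "n = Suc j - Suc i" "k \<le> Suc i" using Suc.hyps(2) Suc.prems(2) by auto
    from Suc.hyps(1)[OF this(1) Suc.prems(1) this(2) Suc.prems(3) anti inv1] obtain d' c' ret where
      v: "updating w k j (Suc i) d1 c1 = Some (d', c', ret)"
      and ret: "if ret then states w \<subseteq> covered w P
       else checked_inv w P d' c' \<and> dist_antitone w d' \<and> d' \<le> d1 \<and>
         (\<forall>q\<in>states w. q \<noteq> init w \<longrightarrow>
          (\<forall>i'\<in>state_endpos w q. Suc i \<le> i' \<longrightarrow> i' \<le> j \<longrightarrow> d' q \<le> enat (i' - k)))" by blast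
    have "updating w k j i d checked = Some (d', c', ret)"
      using u v False ij by (subst updating.simps) simp
    moreover have "d' \<le> d" if "d' \<le> d1"
      using that by (auto simp: le_fun_def d1 split: if_splits)
    moreover have "d' q \<le> enat (i' - k)"
      if "\<not> ret" "q \<in> states w" "q \<noteq> init w" "i' \<in> state_endpos w q" "i \<le> i'" "i' \<le> j" for q i'
    proof (cases "i' = i")
      case True
      then have "d1 q \<le> enat (i' - k)" using that by (simp add: d1)
      moreover have "d' q \<le> d1 q" using ret that(1) by (simp add: le_fun_def)
      ultimately show ?thesis by (rule order_trans[rotated])
    next
      case False
      then show ?thesis using ret that by auto
    qed
    ultimately show ?thesis using ret by auto
  qed
qed

subsection \<open>The main loop\<close>

text \<open>The last premise expresses progress: states first ending beyond \<open>j\<close> are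
  settled. Each round extends this down to \<open>k - 1\<close>, which is below \<open>j\<close>; at
  0 every state would be checked, so the return must come earlier.\<close>

lemma main_loop_spec:
  assumes "j \<le> length w" "P \<subseteq> {1..length w}" "dist_antitone w d" "checked_inv w P d checked"
    "\<forall>q\<in>states w. j < pos w q \<longrightarrow> d q < enat (minlen q)"
  shows "\<exists>P'. main_loop w j d checked P = Some (P', True) \<and> P' \<subseteq> {1..length w} \<and>
    states w \<subseteq> covered w P'"
  using assms
proof (induction j arbitrary: P d checked rule: less_induct)
  case (less j)
  show ?case
  proof (cases "j = 0")
    case True
    have "q \<in> checked" if q: "q \<in> states w" for q
    proof (cases "q = init w")
      case False
      then have "d q < enat (minlen q)" using bspec[OF less.prems(5) q] pos_pos[OF q] True by simp
      then show ?thesis using False q less.prems(4) by (simp add: checked_inv_def)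
    qed (use less.prems(4) in \<open>simp add: checked_inv_def\<close>)
    then have "states w \<subseteq> checked" by blast
    moreover have "checked \<subseteq> covered w P" "checked \<noteq> states w"
      using less.prems(4) by (simp_all add: checked_inv_def)
    \<comment> \<open>The facts are contradictory: \<open>checked\<close> would equal
      \<open>states w\<close>, although the algorithm has not returned.\<close>
    ultimately show ?thesis using covered_subset_states[of w P] by auto
  next
    case False
    from stacking_spec[OF zero_less_one less.prems(1), of d] obtain k where
      k: "stacking w d j 1 = Some k" "1 \<le> k" "k \<le> max 1 j"
      and k_ge: "\<And>q. q \<in> states w \<Longrightarrow> k \<le> pos w q \<Longrightarrow> pos w q \<le> j \<Longrightarrow>
        enat (minlen q) \<le> d q \<Longrightarrow> pos w q + 1 - minlen q \<le> k" by blast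
    have kj: "k \<le> j" using k(3) False by simp
    let ?P = "insert k P"
    have P: "?P \<subseteq> {1..length w}" using less.prems(1,2) k(2) kj by auto
    have "checked_inv w ?P d checked"
      using less.prems(4) covered_mono[of P ?P w, OF subset_insertI]
      unfolding checked_inv_def by (meson subset_trans)
    from updating_spec[OF insertI1 order_refl less.prems(1,3) this] obtain d' c' ret where
      u: "updating w k j k d checked = Some (d', c', ret)"
      and ret: "if ret then states w \<subseteq> covered w ?P
        else checked_inv w ?P d' c' \<and> dist_antitone w d' \<and> d' \<le> d \<and>
          (\<forall>q\<in>states w. q \<noteq> init w \<longrightarrow>
            (\<forall>i\<in>state_endpos w q. k \<le> i \<longrightarrow> i \<le> j \<longrightarrow> d' q \<le> enat (i - k)))" by blast
    show ?thesis
    proof (cases ret)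
      case True
      have "main_loop w j d checked P = Some (?P, True)"
        using False k(1) u True by (subst main_loop.simps) simp
      moreover have "states w \<subseteq> covered w ?P" using ret True by (simp only: if_True)
      ultimately show ?thesis using P by blast
    next
      case nret: False
      then have inv': "checked_inv w ?P d' c'" "dist_antitone w d'" and le: "d' \<le> d"
        and d'_le: "\<And>q i. q \<in> states w \<Longrightarrow> q \<noteq> init w \<Longrightarrow> i \<in> state_endpos w q \<Longrightarrow>
          k \<le> i \<Longrightarrow> i \<le> j \<Longrightarrow> d' q \<le> enat (i - k)"
        using ret by (simp_all only: if_False simp_thms)
      have small: "d' q < enat (minlen q)" if q: "q \<in> states w" "k - 1 < pos w q" for q
      proof (cases "d q < enat (minlen q)")
        case True
        moreover have "d' q \<le> d q" using le by (rule le_funD)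
        ultimately show ?thesis by (rule le_less_trans[rotated])
      next
        case d: False
        \<comment> \<open>A state still unsettled cannot first end beyond \<open>j\<close>, so the
          guarantee of stacking applies to it.\<close>
        have pj: "pos w q \<le> j" using less.prems(5) q(1) d by (meson not_le)
        have ni: "q \<noteq> init w" using q(2) pos_init[of w] by auto
        have "pos w q + 1 - minlen q \<le> k" using k_ge q pj d k(2) by simp
        \<comment> \<open>The choice of \<open>k\<close> makes it fall inside the shortest factor of
          \<open>q\<close> at its first occurrence.\<close>
        then have "pos w q - k < minlen q"
          using minlen_pos[OF q(1) ni] q(2) by linarith
        moreover have "d' q \<le> enat (pos w q - k)"
          using q(2) pj by (intro d'_le q(1) ni pos_in_state_endpos) simp_all
        ultimately show ?thesis by (meson enat_ord_simps(2) order_le_less_trans)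
      qed
      have "k - 1 < j" "k - 1 \<le> length w" using k(2) kj less.prems(1) by auto
      then obtain P' where
        "main_loop w (k - 1) d' c' ?P = Some (P', True)" "P' \<subseteq> {1..length w}"
        "states w \<subseteq> covered w P'"
        using less.IH[of "k - 1" ?P d' c'] P small inv' by blast
      moreover have "main_loop w j d checked P = main_loop w (k - 1) d' c' ?P"
        using False k(1) u nret by (subst main_loop.simps) simp
      ultimately show ?thesis by simp
    qed
  qed
qed

section \<open>From covered states to the attractor property\<close>

lemma word_attractor_if_covered:
  assumes "P \<subseteq> {1..length w}" "states w \<subseteq> covered w P"
  shows "word_attractor w P"
  unfolding word_attractor_def
proof (intro conjI ballI impI assms(1))
  fix u assume u: "u \<in> factors w" "u \<noteq> []"
  let ?q = "delta_init w u"
  have q: "?q \<in> states w" "u \<in> ?q"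
    using delta_init_in_states[OF u(1)] delta_init_eq[OF u(1)] u(1) by auto
  have ep: "state_endpos w ?q = endpos w u" using u(1) by (rule state_endpos_delta_init)
  have "0 \<notin> endpos w u" using u(2) by (simp add: endpos_eq)
  then have "?q \<noteq> init w" using ep state_endpos_init by fastforce
  then obtain i t where it: "i \<in> endpos w u" "t \<in> P" "t \<le> i" "i - t < minlen ?q"
    using subsetD[OF assms(2) q(1)] unfolding covered_def ep[symmetric] by blast
  \<comment> \<open>All factors in a state share their ending positions, so \<open>u\<close> itself
    occurs at \<open>i\<close>. Its length is at least \<open>minlen ?q\<close>, which puts the
    start \<open>b\<close> at or before \<open>t\<close>.\<close>
  obtain b where b: "occurrence w u b i" using it(1) u(2) by (auto simp: endpos_def)
  then have "length u = i + 1 - b" by (auto simp: occurrence_def factor_def)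
  then have "b \<le> t" using it(4) minlen_le[OF q] b by (auto simp: occurrence_def)
  then show "\<exists>i j. occurrence w u i j \<and> (\<exists>t\<in>P. i \<le> t \<and> t \<le> j)"
    using b it by blast
qed

text \<open>A nonempty \<open>w\<close>, as a factor of itself, does not end at 0. This gives the
  invariant \<open>checked \<noteq> states w\<close> at the start.\<close>

lemma states_not_singleton:
  assumes "w \<noteq> []"
  shows "{init w} \<noteq> states w"
proof
  assume "{init w} = states w"
  then have "prefix_state w (length w) = init w" using prefix_state_in_states by blast
  then have "state_endpos w (prefix_state w (length w)) = {0..length w}"
    by (simp add: state_endpos_init)
  moreover have "w \<in> factors w" by (simp add: factors_eq_sublists)
  ultimately have "0 \<in> endpos w w" by (simp add: prefix_state_def factor_def state_endpos_delta_init)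
  then show False using assms by (simp add: endpos_eq)
qed

theorem proposition5:
  fixes \<Sigma> :: "'a set" and w :: "'a list"
  assumes "finite \<Sigma>" and "w \<in> lists \<Sigma>"
  shows "\<exists>P. get_an_attractor w = Some P \<and> word_attractor w P"
proof (cases "w = []")
  case True
  \<comment> \<open>The loop is not entered and the flag is \<open>False\<close>;
    \<open>get_an_attractor\<close> accepts this outcome for the empty word only.\<close>
  have "main_loop w 0 (\<lambda>_. \<infinity>) {init w} {} = Some ({}, False)"
    by (subst main_loop.simps) simp
  then have "get_an_attractor w = Some {}" using True by (simp add: get_an_attractor_def)
  moreover have "word_attractor w {}"
    using True by (simp add: word_attractor_def factors_eq_sublists)
  ultimately show ?thesis by blast
next
  case False
  have "dist_antitone w (\<lambda>_. \<infinity>)" by (simp add: dist_antitone_def antitone_above_def)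
  moreover have "checked_inv w {} (\<lambda>_. \<infinity>) {init w}"
    using states_not_singleton[OF False] by (simp add: checked_inv_def covered_def)
  \<comment> \<open>With \<open>j = length w\<close> the progress premise is vacuous, since no state
    first ends beyond the word.\<close>
  ultimately obtain P where
    P: "main_loop w (length w) (\<lambda>_. \<infinity>) {init w} {} = Some (P, True)"
      "P \<subseteq> {1..length w}" "states w \<subseteq> covered w P"
    using main_loop_spec[of "length w" w "{}" "\<lambda>_. \<infinity>" "{init w}"] pos_le_length
    by (auto simp: not_less)
  then have "get_an_attractor w = Some P" by (simp add: get_an_attractor_def)
  then show ?thesis using word_attractor_if_covered P by blast
qed

end
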